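(* Let $\gamma=\beta_m^2(T_m^{-1})_{mm}$ with $\gamma\,(T_{m,\perp}^{-1})_{11}<1$, and let $S_\perp=T_{m,\perp}-\gamma e_1e_1^{\top}$. Then $$\mathrm{tr}(S_\perp^{-1})=\mathrm{tr}(T_{m,\perp}^{-1})+\frac{\gamma\,(T_{m,\perp}^{-2})_{11}}{1-\gamma\,(T_{m,\perp}^{-1})_{11}},$$ $$(S_\perp^{-1})_{11}=\frac{(T_{m,\perp}^{-1})_{11}}{1-\gamma\,(T_{m,\perp}^{-1})_{11}},$$ $$Q_{m,\perp}S_\perp^{-1}e_1=\frac{Q_{m,\perp}T_{m,\perp}^{-1}e_1}{1-\gamma\,(T_{m,\perp}^{-1})_{11}}.$$
   Context: $A\in\mathbb{R}^{d\times d}$ is symmetric positive definite and $1\le m<d$. Starting from a unit vector $q_1=v_{\mathrm{ref}}/\|v_{\mathrm{ref}}\|_2$, $m$ steps of the Lanczos algorithm (exact arithmetic, no breakdown before step $m$) produce $Q_m\in\mathbb{R}^{d\times m}$ with orthonormal columns, a symmetric tridiagonal positive definite matrix $T_m=Q_m^{\top}AQ_m$, a scalar $\beta_m\ge0$, and a unit vector $q_{m+1}\perp\mathrm{range}(Q_m)$ (any such unit vector if $\beta_m=0$) with $AQ_m=Q_mT_m+\beta_mq_{m+1}e_m^{\top}$. $Q_{m,\perp}\in\mathbb{R}^{d\times(d-m)}$ has orthonormal columns spanning the orthogonal complement of $\mathrm{range}(Q_m)$, with first column $q_{m+1}$; $T_{m,\perp}=Q_{m,\perp}^{\top}AQ_{m,\perp}$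 (symmetric positive definite); $e_1\in\mathbb{R}^{d-m}$ is the first coordinate vector. *)

theory Defs
  imports
    Complex_Main
    "Jordan_Normal_Form.VS_Connect"
    "Jordan_Normal_Form.Gauss_Jordan_Elimination"
begin

text \<open>Rows, columns and coordinates are numbered from 0.\<close>

definition vec_norm2 :: "real vec \<Rightarrow> real" where
  "vec_norm2 v = sqrt (v \<bullet> v)"

definition sym_pos_def :: "nat \<Rightarrow> real mat \<Rightarrow> bool" where
  "sym_pos_def n M \<longleftrightarrow> M \<in> carrier_mat n n \<and> M\<^sup>T = M \<and>
     (\<forall>x \<in> carrier_vec n. x \<noteq> 0\<^sub>v n \<longrightarrow> x \<bullet> (M *\<^sub>v x) > 0)"

definition orthonormal_cols :: "real mat \<Rightarrow> bool" where
  "orthonormal_cols M \<longleftrightarrow> M\<^sup>T * M = 1\<^sub>m (dim_col M)"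

text \<open>Unspecified when \<open>M\<close> is not invertible.\<close>

definition mat_inv :: "real mat \<Rightarrow> real mat" where
  "mat_inv M = the (mat_inverse M)"

definition mat_trace :: "real mat \<Rightarrow> real" where
  "mat_trace M = (\<Sum>i<dim_row M. M $$ (i, i))"

definition outer_prod :: "real vec \<Rightarrow> real vec \<Rightarrow> real mat" where
  "outer_prod u v = mat (dim_vec u) (dim_vec v) (\<lambda>(i, j). u $ i * v $ j)"

text \<open>
  In the usual numbering \<open>q\<^sub>1, q\<^sub>2, \<dots>\<close> of the Lanczos vectors, with \<open>q\<^sub>0 = 0\<close> and
  \<open>\<beta>\<^sub>0 = 0\<close>, the state after \<open>j\<close> steps is \<open>(q\<^sub>j, q\<^sub>j\<^sub>+\<^sub>1, \<beta>\<^sub>j)\<close>. A step breaks down when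
  the residual \<open>r\<close>, whose norm is the new \<open>\<beta>\<close>, vanishes; the next Lanczos vector
  produced by this recursion is then meaningless (it is the zero vector).
\<close>

primrec lanczos :: "real mat \<Rightarrow> real vec \<Rightarrow> nat \<Rightarrow> real vec \<times> real vec \<times> real" where
  "lanczos A v 0 = (0\<^sub>v (dim_vec v), (1 / vec_norm2 v) \<cdot>\<^sub>v v, 0)"
| "lanczos A v (Suc j) =
     (let (p, q, b) = lanczos A v j;
          r = A *\<^sub>v q - (q \<bullet> (A *\<^sub>v q)) \<cdot>\<^sub>v q - b \<cdot>\<^sub>v p
      in (q, (1 / vec_norm2 r) \<cdot>\<^sub>v r, vec_norm2 r))"

text \<open>Thus \<open>lanczos_vec A v i\<close> is \<open>q\<^sub>i\<^sub>+\<^sub>1\<close>, \<open>lanczos_alpha A v i\<close> is \<open>\<alpha>\<^sub>i\<^sub>+\<^sub>1\<close>, and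
  \<open>lanczos_beta A v i\<close> is \<open>\<beta>\<^sub>i\<close>.\<close>

definition lanczos_vec :: "real mat \<Rightarrow> real vec \<Rightarrow> nat \<Rightarrow> real vec" where
  "lanczos_vec A v i = fst (snd (lanczos A v i))"

definition lanczos_alpha :: "real mat \<Rightarrow> real vec \<Rightarrow> nat \<Rightarrow> real" where
  "lanczos_alpha A v i = lanczos_vec A v i \<bullet> (A *\<^sub>v lanczos_vec A v i)"

definition lanczos_beta :: "real mat \<Rightarrow> real vec \<Rightarrow> nat \<Rightarrow> real" where
  "lanczos_beta A v i = snd (snd (lanczos A v i))"

definition lanczos_Q :: "real mat \<Rightarrow> real vec \<Rightarrow> nat \<Rightarrow> real mat" where
  "lanczos_Q A v m = mat_of_cols (dim_row A) (map (lanczos_vec A v) [0..<m])"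

definition lanczos_T :: "real mat \<Rightarrow> real vec \<Rightarrow> nat \<Rightarrow> real mat" where
  "lanczos_T A v m = mat m m (\<lambda>(i, j).
     if i = j then lanczos_alpha A v i
     else if j = Suc i \<or> i = Suc j then lanczos_beta A v (max i j)
     else 0)"

text \<open>A vanishing \<open>\<beta>\<^sub>m\<close> in the last step is permitted.\<close>

definition lanczos_no_breakdown :: "real mat \<Rightarrow> real vec \<Rightarrow> nat \<Rightarrow> bool" where
  "lanczos_no_breakdown A v m \<longleftrightarrow> (\<forall>j. 1 \<le> j \<and> j < m \<longrightarrow> lanczos_beta A v j \<noteq> 0)"

text \<open>
  When \<open>\<beta>\<^sub>m \<noteq> 0\<close> the last equation forces \<open>q\<close> to be the next Lanczos vector; when
  \<open>\<beta>\<^sub>m = 0\<close> it leaves \<open>q\<close> an arbitrary unit vector orthogonal to the range of \<open>Q\<^sub>m\<close>.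
\<close>

definition lanczos_next :: "real mat \<Rightarrow> real vec \<Rightarrow> nat \<Rightarrow> real vec \<Rightarrow> bool" where
  "lanczos_next A v m q \<longleftrightarrow>
     (let d = dim_row A; Q = lanczos_Q A v m; T = lanczos_T A v m; \<beta> = lanczos_beta A v m in
      q \<in> vec_module.orthogonal_complement d (vec_space.col_space d Q) \<and>
      vec_norm2 q = 1 \<and>
      A * Q = Q * T + \<beta> \<cdot>\<^sub>m outer_prod q (unit_vec m (m - 1)))"

end

theory Submission
  imports Defs
begin

text \<open>
  \<open>T\<^sub>m\<^sub>,\<^sub>\<bottom>\<close> is a compression of \<open>A\<close> and hence positive definite, so all three identities
  follow from the Sherman--Morrison formula
  \<open>S\<^sub>\<bottom>\<^sup>-\<^sup>1 = B + \<gamma> / (1 - \<gamma> B\<^sub>1\<^sub>1) (B e\<^sub>1) (B e\<^sub>1)\<^sup>T\<close> with \<open>B = T\<^sub>m\<^sub>,\<^sub>\<bottom>\<^sup>-\<^sup>1\<close> symmetric, on taking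
  the trace and applying both sides to \<open>e\<^sub>1\<close>.
\<close>

lemma outer_prod_carrier [simp]:
  "u \<in> carrier_vec n \<Longrightarrow> v \<in> carrier_vec k \<Longrightarrow> outer_prod u v \<in> carrier_mat n k"
  by (auto simp: outer_prod_def)

lemma outer_prod_index:
  "i < dim_vec u \<Longrightarrow> j < dim_vec v \<Longrightarrow> outer_prod u v $$ (i, j) = u $ i * v $ j"
  by (simp add: outer_prod_def)

lemma mult_outer_prod:
  assumes "M \<in> carrier_mat k n" "u \<in> carrier_vec n"
  shows "M * outer_prod u v = outer_prod (M *\<^sub>v u) v"
  using assms
  by (intro eq_matI) (auto simp: outer_prod_def scalar_prod_def sum_distrib_right mult.assoc)

text \<open>Reading \<open>outer_prod u v\<close> as the product of the column u and the row of v,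
  this is associativity. The transpose appears because the row of v times \<open>M\<close> is stored
  as a vector.\<close>

lemma outer_prod_mult:
  assumes "M \<in> carrier_mat n k" "v \<in> carrier_vec n"
  shows "outer_prod u v * M = outer_prod u (M\<^sup>T *\<^sub>v v)"
  using assms
  by (intro eq_matI) (auto simp: outer_prod_def scalar_prod_def sum_distrib_left ac_simps)

lemma outer_prod_smult_left: "outer_prod (c \<cdot>\<^sub>v u) v = c \<cdot>\<^sub>m outer_prod u v"
  by (intro eq_matI) (auto simp: outer_prod_def)

lemma outer_prod_mult_vec:
  assumes "v \<in> carrier_vec n" "x \<in> carrier_vec n"
  shows "outer_prod u v *\<^sub>v x = (v \<bullet> x) \<cdot>\<^sub>v u"
  using assms
  by (intro eq_vecI) (auto simp: outer_prod_def scalar_prod_def sum_distrib_left ac_simps)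

lemma mat_trace_outer_prod:
  assumes "dim_vec v = dim_vec u"
  shows "mat_trace (outer_prod u v) = u \<bullet> v"
  using assms by (simp add: mat_trace_def outer_prod_def scalar_prod_def lessThan_atLeast0)

lemma mat_trace_add:
  assumes "M \<in> carrier_mat n n" "N \<in> carrier_mat n n"
  shows "mat_trace (M + N) = mat_trace M + mat_trace N"
  using assms by (simp add: mat_trace_def sum.distrib)

lemma mat_trace_smult:
  assumes "M \<in> carrier_mat n n"
  shows "mat_trace (c \<cdot>\<^sub>m M) = c * mat_trace M"
  using assms by (simp add: mat_trace_def sum_distrib_left)

text \<open>A right inverse of a square matrix is two-sided, so \<open>M\<close> is a unit and
  \<open>mat_inverse\<close> cannot return \<open>None\<close>; the matrix it does return equals
  \<open>N\<close> by associativity. Thus one product determines \<open>mat_inv\<close>.\<close>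

lemma mat_inv_unique:
  assumes M: "M \<in> carrier_mat n n" and N: "N \<in> carrier_mat n n" and MN: "M * N = 1\<^sub>m n"
  shows "mat_inv M = N"
proof -
  have NM: "N * M = 1\<^sub>m n"
    using mat_mult_left_right_inverse[OF M N MN] .
  have "mat_inverse M \<noteq> None"
  proof
    assume "mat_inverse M = None"
    \<comment> \<open>The last argument of \<open>ring_mat\<close> only fills the extension slot of
      the record and does not affect the units, so \<open>undefined\<close> will do.\<close>
    then have "M \<notin> Units (ring_mat TYPE(real) n undefined)"
      by (rule mat_inverse(1)[OF M])
    then show False
      using M N MN NM by (auto simp: Units_def ring_mat_def)
  qed
  then obtain B where B: "mat_inverse M = Some B"
    by auto
  from mat_inverse(2)[OF M B] have BM: "B * M = 1\<^sub>m n" "B \<in> carrier_mat n n"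
    by auto
  have "B = B * (M * N)"
    using MN BM by simp
  also have "\<dots> = N"
    using BM M N assoc_mult_mat[OF BM(2) M N] by simp
  finally show ?thesis
    using B by (simp add: mat_inv_def)
qed

text \<open>A nonzero kernel vector would make the quadratic form vanish, so the determinant is
  nonzero. Transposing \<open>N * M = 1\<^sub>m n\<close> shows that the transpose of
  \<open>N\<close> is again an inverse of the symmetric \<open>M\<close>, hence equal to
  \<open>N\<close>.\<close>

lemma sym_pos_def_mat_inv:
  assumes "sym_pos_def n M"
  shows "mat_inv M \<in> carrier_mat n n" "M * mat_inv M = 1\<^sub>m n"
    "(mat_inv M)\<^sup>T = mat_inv M"
proof -
  have M: "M \<in> carrier_mat n n" and sym: "M\<^sup>T = M"
    and pos: "\<And>x. x \<in> carrier_vec n \<Longrightarrow> x \<noteq> 0\<^sub>v n \<Longrightarrow> x \<bullet> (M *\<^sub>v x) > 0"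
    using assms by (auto simp: sym_pos_def_def)
  have "det M \<noteq> 0"
  proof
    assume "det M = 0"
    then obtain x where x: "x \<in> carrier_vec n" "x \<noteq> 0\<^sub>v n" "M *\<^sub>v x = 0\<^sub>v n"
      using det_0_iff_vec_prod_zero[OF M] by auto
    then show False
      using pos[of x] by simp
  qed
  then obtain N where N: "N \<in> carrier_mat n n" "M * N = 1\<^sub>m n" "N * M = 1\<^sub>m n"
    using det_non_zero_imp_unit[OF M, of undefined] by (auto simp: Units_def ring_mat_def)
  have inv: "mat_inv M = N"
    using mat_inv_unique[OF M N(1,2)] .
  show "mat_inv M \<in> carrier_mat n n" "M * mat_inv M = 1\<^sub>m n"
    using N inv by auto
  have "M * N\<^sup>T = (N * M)\<^sup>T"
    using transpose_mult[OF N(1) M] sym by simp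
  then have "M * N\<^sup>T = 1\<^sub>m n"
    using N by simp
  then show "(mat_inv M)\<^sup>T = mat_inv M"
    using mat_inv_unique[OF M, of "N\<^sup>T"] N inv by simp
qed

text \<open>The quadratic form of the compression at x is that of \<open>A\<close> at
  \<open>V *\<^sub>v x\<close>, and orthonormal columns make \<open>V\<close> injective, with its
  transpose as left inverse.\<close>

lemma sym_pos_def_compression:
  assumes "sym_pos_def d A" and V: "V \<in> carrier_mat d n" and "orthonormal_cols V"
  shows "sym_pos_def n (V\<^sup>T * A * V)"
proof -
  have A: "A \<in> carrier_mat d d" and sym: "A\<^sup>T = A"
    and pos: "\<And>x. x \<in> carrier_vec d \<Longrightarrow> x \<noteq> 0\<^sub>v d \<Longrightarrow> x \<bullet> (A *\<^sub>v x) > 0"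
    using assms by (auto simp: sym_pos_def_def)
  have VV: "V\<^sup>T * V = 1\<^sub>m n"
    using assms by (simp add: orthonormal_cols_def)
  have "(V\<^sup>T * A * V)\<^sup>T = V\<^sup>T * (A * V)"
    using V A sym transpose_mult[of "V\<^sup>T * A" n d V n] transpose_mult[of "V\<^sup>T" n d A d] by simp
  also have "\<dots> = V\<^sup>T * A * V"
    using V A assoc_mult_mat[of "V\<^sup>T" n d A d V n] by simp
  finally have S: "(V\<^sup>T * A * V)\<^sup>T = V\<^sup>T * A * V" .
  have "x \<bullet> ((V\<^sup>T * A * V) *\<^sub>v x) > 0" if x: "x \<in> carrier_vec n" "x \<noteq> 0\<^sub>v n" for x
  proof -
    have Vx: "V *\<^sub>v x \<in> carrier_vec d"
      using V x by simp
    have "V *\<^sub>v x \<noteq> 0\<^sub>v d"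
    proof
      assume 0: "V *\<^sub>v x = 0\<^sub>v d"
      have "x = V\<^sup>T *\<^sub>v (V *\<^sub>v x)"
        using VV V x assoc_mult_mat_vec[of "V\<^sup>T" n d V n x] by simp
      then have "x = 0\<^sub>v n"
        using V unfolding 0 by auto
      with x show False by simp
    qed
    then have "(V *\<^sub>v x) \<bullet> (A *\<^sub>v (V *\<^sub>v x)) > 0"
      by (rule pos[OF Vx])
    moreover have "(V\<^sup>T * A * V) *\<^sub>v x = V\<^sup>T *\<^sub>v (A *\<^sub>v (V *\<^sub>v x))"
      using V A x assoc_mult_mat_vec[of "V\<^sup>T * A" n d V n x]
        assoc_mult_mat_vec[of "V\<^sup>T" n d A d "V *\<^sub>v x"] by simp
    moreover have "x \<bullet> (V\<^sup>T *\<^sub>v (A *\<^sub>v (V *\<^sub>v x))) = (V *\<^sub>v x) \<bullet> (A *\<^sub>v (V *\<^sub>v x))"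
      using transpose_vec_mult_scalar[OF V x(1), of "A *\<^sub>v (V *\<^sub>v x)"] A V Vx x
        comm_scalar_prod[of x n "V\<^sup>T *\<^sub>v (A *\<^sub>v (V *\<^sub>v x))"]
        comm_scalar_prod[of "V *\<^sub>v x" d "A *\<^sub>v (V *\<^sub>v x)"]
      by simp
    ultimately show ?thesis by simp
  qed
  then show ?thesis
    using S A V by (auto simp: sym_pos_def_def)
qed

text \<open>Expanding the product leaves the identity plus a multiple of the single rank-one matrix
  \<open>P\<close>; the coefficient in front of the correction is chosen to make that multiple
  vanish.\<close>

lemma sherman_morrison:
  assumes M: "M \<in> carrier_mat n n" and B: "B \<in> carrier_mat n n" and MB: "M * B = 1\<^sub>m n"
    and u: "u \<in> carrier_vec n" and v: "v \<in> carrier_vec n"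
    and nz: "1 - g * (v \<bullet> (B *\<^sub>v u)) \<noteq> 0"
  shows "(M - g \<cdot>\<^sub>m outer_prod u v) *
    (B + (g / (1 - g * (v \<bullet> (B *\<^sub>v u)))) \<cdot>\<^sub>m outer_prod (B *\<^sub>v u) (B\<^sup>T *\<^sub>v v)) = 1\<^sub>m n"
proof -
  define s where "s = v \<bullet> (B *\<^sub>v u)"
  define c where "c = g / (1 - g * s)"
  define P where "P = outer_prod u (B\<^sup>T *\<^sub>v v)"
  define W where "W = outer_prod (B *\<^sub>v u) (B\<^sup>T *\<^sub>v v)"
  \<comment> \<open>This is the total coefficient of \<open>P\<close> in the expansion, and the only
    place where the denominator must be nonzero.\<close>
  have c: "c - g - g * (c * s) = 0"
    using nz by (simp add: c_def s_def field_simps)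
  have Bu: "B *\<^sub>v u \<in> carrier_vec n" and Bv: "B\<^sup>T *\<^sub>v v \<in> carrier_vec n"
    using B u v by auto
  have P: "P \<in> carrier_mat n n" and W: "W \<in> carrier_mat n n"
    and U: "outer_prod u v \<in> carrier_mat n n"
    using u v Bu Bv by (auto simp: P_def W_def)
  have "M *\<^sub>v (B *\<^sub>v u) = u"
    using assoc_mult_mat_vec[OF M B u] MB u by simp
  then have MW: "M * W = P"
    unfolding W_def P_def using mult_outer_prod[OF M Bu] by simp
  have UB: "outer_prod u v * B = P"
    unfolding P_def by (rule outer_prod_mult[OF B v])
  \<comment> \<open>The inner factors v and \<open>B *\<^sub>v u\<close> contract to the scalar
    \<open>s\<close>, so no second rank-one direction arises.\<close>
  have UW: "outer_prod u v * W = s \<cdot>\<^sub>m P"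
    unfolding P_def W_def s_def mult_outer_prod[OF outer_prod_carrier[OF u v] Bu]
    by (simp add: outer_prod_mult_vec[OF v Bu] outer_prod_smult_left)
  have "(M - g \<cdot>\<^sub>m outer_prod u v) * (B + c \<cdot>\<^sub>m W) =
      (M * B + c \<cdot>\<^sub>m (M * W)) - (g \<cdot>\<^sub>m (outer_prod u v * B) + g \<cdot>\<^sub>m (c \<cdot>\<^sub>m (outer_prod u v * W)))"
    using M B U W minus_mult_distrib_mat[of M n n "g \<cdot>\<^sub>m outer_prod u v" "B + c \<cdot>\<^sub>m W" n]
      mult_add_distrib_mat[of M n n B n "c \<cdot>\<^sub>m W"]
      mult_add_distrib_mat[of "outer_prod u v" n n B n "c \<cdot>\<^sub>m W"]
      mult_smult_assoc_mat[of "outer_prod u v" n n "B + c \<cdot>\<^sub>m W" n g]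
      add_smult_distrib_left_mat[of "outer_prod u v * B" n n "c \<cdot>\<^sub>m (outer_prod u v * W)" g]
      mult_smult_distrib[of M n n W n c] mult_smult_distrib[of "outer_prod u v" n n W n c]
    by simp
  also have "\<dots> = (1\<^sub>m n + c \<cdot>\<^sub>m P) - (g \<cdot>\<^sub>m P + g \<cdot>\<^sub>m (c \<cdot>\<^sub>m (s \<cdot>\<^sub>m P)))"
    by (simp add: MB MW UB UW)
  also have "\<dots> = 1\<^sub>m n"
  proof (rule eq_matI)
    fix i j assume "i < dim_row (1\<^sub>m n :: real mat)" "j < dim_col (1\<^sub>m n :: real mat)"
    then have ij: "i < n" "j < n" by auto
    have "c * p - (g * p + g * (c * (s * p))) = 0" for p
      using arg_cong[OF c, of "\<lambda>x. x * p"] by (simp add: algebra_simps)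
    from this[of "P $$ (i, j)"]
    show "((1\<^sub>m n + c \<cdot>\<^sub>m P) - (g \<cdot>\<^sub>m P + g \<cdot>\<^sub>m (c \<cdot>\<^sub>m (s \<cdot>\<^sub>m P)))) $$ (i, j) = 1\<^sub>m n $$ (i, j)"
      using ij P by simp
  qed (use P in auto)
  finally show ?thesis
    by (simp add: c_def s_def W_def)
qed

theorem proposition23:
  fixes A Q T Qp Tp Sp :: "real mat"
    and vref q :: "real vec"
    and d m :: nat
    and \<beta> \<gamma> :: real
  assumes "sym_pos_def d A"
    and "1 \<le> m" and "m < d"
    and "vref \<in> carrier_vec d" and "vref \<noteq> 0\<^sub>v d"
    and "lanczos_no_breakdown A vref m"
    and "Q = lanczos_Q A vref m"
    and "T = lanczos_T A vref m"
    and "\<beta> = lanczos_beta A vref m"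
    and "lanczos_next A vref m q"
    and "Qp \<in> carrier_mat d (d - m)"
    and "orthonormal_cols Qp"
    and "vec_space.col_space d Qp =
         vec_module.orthogonal_complement d (vec_space.col_space d Q)"
    and "col Qp 0 = q"
    and "Tp = Qp\<^sup>T * A * Qp"
    and "\<gamma> = \<beta>\<^sup>2 * mat_inv T $$ (m - 1, m - 1)"
    and "\<gamma> * mat_inv Tp $$ (0, 0) < 1"
    and "Sp = Tp - \<gamma> \<cdot>\<^sub>m outer_prod (unit_vec (d - m) 0) (unit_vec (d - m) 0)"
  shows "invertible_mat Sp
    \<and> mat_trace (mat_inv Sp) =
        mat_trace (mat_inv Tp)
        + \<gamma> * (mat_inv Tp ^\<^sub>m 2) $$ (0, 0) / (1 - \<gamma> * mat_inv Tp $$ (0, 0))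
    \<and> mat_inv Sp $$ (0, 0) = mat_inv Tp $$ (0, 0) / (1 - \<gamma> * mat_inv Tp $$ (0, 0))
    \<and> Qp *\<^sub>v (mat_inv Sp *\<^sub>v unit_vec (d - m) 0) =
        (1 / (1 - \<gamma> * mat_inv Tp $$ (0, 0))) \<cdot>\<^sub>v (Qp *\<^sub>v (mat_inv Tp *\<^sub>v unit_vec (d - m) 0))"
proof -
  define n where "n = d - m"
  define e :: "real vec" where "e = unit_vec n 0"
  define B where "B = mat_inv Tp"
  define w where "w = B *\<^sub>v e"
  define b where "b = B $$ (0, 0)"
  define c where "c = \<gamma> / (1 - \<gamma> * b)"
  \<comment> \<open>The Sherman-Morrison candidate for the inverse of \<open>Sp\<close>, with both
    vectors equal to \<open>e\<close>; symmetry of \<open>B\<close> makes both factors of the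
    correction equal to \<open>w\<close>.\<close>
  define R where "R = B + c \<cdot>\<^sub>m outer_prod w w"
  have n: "0 < n" and V: "Qp \<in> carrier_mat d n"
    using assms by (auto simp: n_def)
  have spd: "sym_pos_def n Tp"
    using sym_pos_def_compression[OF assms(1) V] assms by simp
  then have Tp: "Tp \<in> carrier_mat n n"
    by (simp add: sym_pos_def_def)
  have B: "B \<in> carrier_mat n n" "Tp * B = 1\<^sub>m n" "B\<^sup>T = B"
    using sym_pos_def_mat_inv[OF spd] by (simp_all add: B_def)
  have e: "e \<in> carrier_vec n"
    by (simp add: e_def)
  have w: "w \<in> carrier_vec n"
    using B e by (simp add: w_def)
  have w_col: "w = col B 0"
    using B n by (intro eq_vecI) (auto simp: w_def e_def)
  \<comment> \<open>Symmetry of \<open>B\<close> makes its first column also its first row; this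
    later turns \<open>w \<bullet> w\<close> into an entry of the square of
    \<open>B\<close>.\<close>
  have w_row: "w = row B 0"
    using B n col_transpose[of 0 B] by (simp add: w_col)
  have w0: "w $ 0 = b"
    using B n by (simp add: w_col b_def)
  have ew: "e \<bullet> w = b" and we: "w \<bullet> e = b"
    using w n w0 by (simp_all add: e_def)
  have nz: "1 - \<gamma> * b \<noteq> 0"
    using assms(17) by (simp add: b_def B_def)
  have Sp: "Sp = Tp - \<gamma> \<cdot>\<^sub>m outer_prod e e"
    using assms by (simp add: e_def n_def)
  have Spc: "Sp \<in> carrier_mat n n"
    using Tp e unfolding Sp by (intro minus_carrier_mat smult_carrier_mat outer_prod_carrier)
  have Rc: "R \<in> carrier_mat n n"
    using B w by (simp add: R_def)
  have SR: "Sp * R = 1\<^sub>m n"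
    using sherman_morrison[OF Tp B(1,2) e e, of \<gamma>] nz B(3) ew
    by (simp add: Sp R_def c_def flip: w_def)
  have inv: "mat_inv Sp = R"
    by (rule mat_inv_unique[OF Spc Rc SR])
  \<comment> \<open>This conjunct ensures that \<open>mat_inv Sp\<close> in the other three is a
    genuine inverse and not an unspecified value.\<close>
  have "invertible_mat Sp"
    using SR mat_mult_left_right_inverse[OF Spc Rc SR] Spc Rc
    by (auto simp: invertible_mat_def inverts_mat_def)
  \<comment> \<open>The corner of the square is first row times first column of \<open>B\<close>,
    which is also the trace of \<open>outer_prod w w\<close>.\<close>
  moreover have "(B ^\<^sub>m 2) $$ (0, 0) = w \<bullet> w"
    using B n by (simp add: numeral_2_eq_2 flip: w_col w_row)
  then have "mat_trace R = mat_trace B + \<gamma> * (B ^\<^sub>m 2) $$ (0, 0) / (1 - \<gamma> * b)"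
    using B(1) w mat_trace_add[of B n "c \<cdot>\<^sub>m outer_prod w w"]
      mat_trace_smult[of "outer_prod w w" n c] mat_trace_outer_prod[of w w]
    by (simp add: R_def c_def)
  moreover
  \<comment> \<open>The corner entry of \<open>R\<close> and the vector \<open>R *\<^sub>v e\<close>
    are both scaled by this factor relative to \<open>B\<close>, so it yields the last two
    identities.\<close>
  have scale: "1 + c * b = 1 / (1 - \<gamma> * b)"
    using nz by (simp add: c_def field_simps)
  have "R $$ (0, 0) = (1 + c * b) * b"
    using n B w w0 by (simp add: R_def outer_prod_index b_def algebra_simps)
       (simp add: outer_prod_def w0 b_def)
  then have "R $$ (0, 0) = b / (1 - \<gamma> * b)"
    by (simp add: scale)
  moreover have "(c \<cdot>\<^sub>m outer_prod w w) *\<^sub>v e = c \<cdot>\<^sub>v (outer_prod w w *\<^sub>v e)"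
    using w e by (intro eq_vecI) (auto simp: outer_prod_def)
  \<comment> \<open>The rank-one correction maps \<open>e\<close> to a multiple of \<open>w\<close>,
    which is already \<open>B *\<^sub>v e\<close>; hence only the length changes, not the line
    spanned.\<close>
  then have "R *\<^sub>v e = w + c \<cdot>\<^sub>v (b \<cdot>\<^sub>v w)"
    using B w e we unfolding R_def
    by (simp add: add_mult_distrib_mat_vec[of _ n n] 
        outer_prod_mult_vec[of _ n] flip: w_def)
  then have "R *\<^sub>v e = (1 / (1 - \<gamma> * b)) \<cdot>\<^sub>v w"
    using w by (simp add: smult_smult_assoc add_smult_distrib_vec flip: scale)
  then have "Qp *\<^sub>v (R *\<^sub>v e) = (1 / (1 - \<gamma> * b)) \<cdot>\<^sub>v (Qp *\<^sub>v w)"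
    using mult_mat_vec[OF V w] by simp
  ultimately show ?thesis
    unfolding inv by (simp add: B_def b_def w_def e_def n_def)
qed

end
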